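(* Let $\langle X,d\rangle$ be a Bourbaki quasi-complete metric space. Then $X$ is uniformly star superparacompact if and only if for every $\varepsilon>0$ there exists $\delta>0$ such that for every nonempty closed subset $A$ of $X$, if $\overline{f_c}(A)<\delta$, then $\eta^*(A)<\varepsilon$.
   Context: Metric spaces are assumed to contain at least two points. For $x\in X$ and $\varepsilon>0$, $S^\infty_d(x,\varepsilon)$ is the set of all $y\in X$ for which there is a finite sequence $x=x_0,x_1,\dots,x_n=y$ in $X$ with $d(x_{i-1},x_i)<\varepsilon$ for $i=1,\dots,n$. Define $f_c(x)=\sup\{\varepsilon>0: S^\infty_d(x,\varepsilon)\text{ is compact}\}\in[0,\infty]$ if $S^\infty_d(x,\varepsilon)$ is compact for some $\varepsilon>0$, and $f_c(x)=0$ otherwise. For nonempty $A\subseteq X$, $\overline{f_c}(A)=\sup\{f_c(a):a\in A\}$ and $\eta^*(A)=\inf\{\varepsilon>0: A\subseteq\bigcup_{i=1}^k S^\infty_d(x_i,\varepsilon)\text{ for some finite }\{x_1,\dots,x_k\}\subseteq X\}\in[0,\infty]$ (with $\inf\emptyset=\infty$). A sequence $\langle x_n\rangle$ is Bourbaki quasi-Cauchy in $X$ if for every $\varepsilon>0$ there exist $n_0\in\mathbb N$ and $p\in X$ with $x_n\in S^\infty_d(p,\varepsilon)$ for every $n\ge n_0$; $X$ is Bourbaki quasi-complete if every Bourbaki quasi-Cauchy sequence in $X$ has a cluster point in $X$. $X$ is uniformly star superparacompact if for each open cover $\mathcal V$ of $X$ there exist $\mu>0$ and an open cover $\mathcal U$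 of $X$ refining $\mathcal V$ (each member of $\mathcal U$ is contained in some member of $\mathcal V$) such that for each $x\in X$, $S^\infty_d(x,\mu)$ intersects at most finitely many members of $\mathcal U$. *)

theory Defs
  imports "HOL-Analysis.Analysis"
begin

text \<open>
  A metric space \<open>X\<close> is a type of class \<^class>\<open>metric_space\<close>, so that \<open>X\<close> is \<^term>\<open>UNIV\<close>.
\<close>

definition chain_comp :: "'a::metric_space \<Rightarrow> real \<Rightarrow> 'a set" where
  "chain_comp x \<epsilon> =
    {y. \<exists>(n::nat) u. u 0 = x \<and> u n = y \<and> (\<forall>i\<in>{1..n}. dist (u (i - 1)) (u i) < \<epsilon>)}"

definition f_c :: "'a::metric_space \<Rightarrow> ennreal" where
  "f_c x =
    (if \<exists>\<epsilon>>0. compact (chain_comp x \<epsilon>)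
     then SUP \<epsilon>\<in>{\<epsilon>. \<epsilon> > 0 \<and> compact (chain_comp x \<epsilon>)}. ennreal \<epsilon>
     else 0)"

definition f_c_sup :: "'a::metric_space set \<Rightarrow> ennreal" where
  "f_c_sup A = (SUP a\<in>A. f_c a)"

text \<open>In \<^typ>\<open>ennreal\<close>, the infimum of the empty set is \<open>\<infinity>\<close>.\<close>

definition eta_star :: "'a::metric_space set \<Rightarrow> ennreal" where
  "eta_star A =
    (INF \<epsilon>\<in>{\<epsilon>. \<epsilon> > 0 \<and> (\<exists>F. finite F \<and> A \<subseteq> (\<Union>x\<in>F. chain_comp x \<epsilon>))}. ennreal \<epsilon>)"

definition bourbaki_quasi_Cauchy :: "(nat \<Rightarrow> 'a::metric_space) \<Rightarrow> bool" where
  "bourbaki_quasi_Cauchy s \<longleftrightarrow>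
    (\<forall>\<epsilon>>0. \<exists>n0 p. \<forall>n\<ge>n0. s n \<in> chain_comp p \<epsilon>)"

definition seq_cluster_point :: "(nat \<Rightarrow> 'a::topological_space) \<Rightarrow> 'a \<Rightarrow> bool" where
  "seq_cluster_point s p \<longleftrightarrow>
    (\<forall>U. open U \<and> p \<in> U \<longrightarrow> (\<exists>\<^sub>F n in sequentially. s n \<in> U))"

definition bourbaki_quasi_complete :: "'a::metric_space itself \<Rightarrow> bool" where
  "bourbaki_quasi_complete _ \<longleftrightarrow>
    (\<forall>s::nat \<Rightarrow> 'a. bourbaki_quasi_Cauchy s \<longrightarrow> (\<exists>p. seq_cluster_point s p))"

definition open_cover :: "'a::topological_space set set \<Rightarrow> bool" where
  "open_cover \<V> \<longleftrightarrow> (\<forall>V\<in>\<V>. open V) \<and> \<Union>\<V> = UNIV"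

definition uniformly_star_superparacompact :: "'a::metric_space itself \<Rightarrow> bool" where
  "uniformly_star_superparacompact _ \<longleftrightarrow>
    (\<forall>\<V>::'a set set. open_cover \<V> \<longrightarrow>
      (\<exists>\<mu>>0. \<exists>\<U>. open_cover \<U> \<and> (\<forall>U\<in>\<U>. \<exists>V\<in>\<V>. U \<subseteq> V) \<and>
        (\<forall>x. finite {U\<in>\<U>. chain_comp x \<mu> \<inter> U \<noteq> {}})))"

end

theory Submission
  imports Defs "HOL-Library.Diagonal_Subsequence"
begin

text \<open>
  The sets \<open>chain_comp x \<epsilon>\<close> are the classes of an equivalence relation, they are clopen, and
  they shrink with \<open>\<epsilon>\<close>. Hence compactness of \<open>chain_comp x \<epsilon>\<close> passes to smaller \<open>\<epsilon>\<close>, and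
  \<open>f_c x\<close> is the threshold below which these components are compact.

  Suppose that sets with small \<^const>\<open>f_c\<close> fail to have small \<^const>\<open>eta_star\<close>. Then there are points
  \<open>x\<^sub>n\<close> in pairwise different \<open>\<epsilon>\<close>-components whose \<open>r\<^sub>n\<close>-components, with \<open>r\<^sub>n \<rightarrow> 0\<close>, are not compact.
  Each of these contains an infinite set without limit points, and the union \<open>D\<close> of these sets
  still has no limit point (\<open>scattered_noncompact_components\<close>). The open sets that meet \<open>D\<close> in a
  finite set form a cover, and no uniform \<open>\<mu>\<close> works for it: once \<open>r\<^sub>n \<le> \<mu>\<close>, finitely many members of a
  refinement cannot cover the infinite set \<open>D \<inter> chain_comp x\<^sub>n \<mu>\<close>.

  Conversely, under the smallness condition every sequence along which \<^const>\<open>f_c\<close> tends to \<open>0\<close> is,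
  for each \<open>\<epsilon>\<close>, eventually covered by finitely many \<open>\<epsilon>\<close>-components. A diagonal argument yields a
  Bourbaki quasi-Cauchy subsequence, hence a cluster point, where \<^const>\<open>f_c\<close> vanishes
  (\<open>f_c_null_sequence_cluster\<close>). So the zero set of \<^const>\<open>f_c\<close> is compact, and any open set around it
  contains all points with \<open>f_c x \<le> \<mu>\<close> for some \<open>\<mu> > 0\<close>. Given an open cover, cover the zero set by
  finitely many members; every point they miss lies in a compact \<open>\<mu>\<close>-component, which can be treated
  on its own, because different \<open>\<mu>\<close>-components are disjoint.
\<close>

section \<open>Chain components\<close>

lemma chain_comp_iff_rtranclp:
  "y \<in> chain_comp x e \<longleftrightarrow> (\<lambda>a b. dist a b < e)\<^sup>*\<^sup>* x y"
proof -
  have "(\<forall>i\<in>{1..n}. dist (u (i - 1)) (u i) < e) \<longleftrightarrow> (\<forall>i<n. dist (u i) (u (Suc i)) < e)"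
    for n :: nat and u :: "nat \<Rightarrow> 'a"
  proof
    assume "\<forall>i\<in>{1..n}. dist (u (i - 1)) (u i) < e"
    then have "dist (u (Suc i - 1)) (u (Suc i)) < e" if "i < n" for i
      using that by (metis Suc_leI atLeastAtMost_iff le_add1 plus_1_eq_Suc)
    then show "\<forall>i<n. dist (u i) (u (Suc i)) < e" by simp
  next
    assume r: "\<forall>i<n. dist (u i) (u (Suc i)) < e"
    show "\<forall>i\<in>{1..n}. dist (u (i - 1)) (u i) < e"
    proof
      fix i assume "i \<in> {1..n}"
      then have "i - 1 < n" "Suc (i - 1) = i" by auto
      then show "dist (u (i - 1)) (u i) < e" using r by metis
    qed
  qed
  then show ?thesis
    unfolding chain_comp_def rtranclp_power relpowp_fun_conv by simp
qed

lemma chain_comp_refl [simp]: "x \<in> chain_comp x e"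
  by (simp add: chain_comp_iff_rtranclp)

lemma chain_comp_sym: "y \<in> chain_comp x e \<Longrightarrow> x \<in> chain_comp y e"
  unfolding chain_comp_iff_rtranclp
  by (rule sympD[OF symp_rtranclp]) (auto intro: sympI simp: dist_commute)

lemma chain_comp_trans: "y \<in> chain_comp x e \<Longrightarrow> z \<in> chain_comp y e \<Longrightarrow> z \<in> chain_comp x e"
  unfolding chain_comp_iff_rtranclp by simp

lemma chain_comp_eq: "y \<in> chain_comp x e \<Longrightarrow> chain_comp y e = chain_comp x e"
  by (blast intro: chain_comp_sym chain_comp_trans)

lemma chain_comp_mono: "e \<le> e' \<Longrightarrow> chain_comp x e \<subseteq> chain_comp x e'"
  unfolding subset_iff chain_comp_iff_rtranclp
  by (auto elim: rtranclp_mono[THEN predicate2D, rotated])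

lemma ball_subset_chain_comp: "ball x e \<subseteq> chain_comp x e"
  by (auto simp: chain_comp_iff_rtranclp)

lemma open_chain_comp: "e > 0 \<Longrightarrow> open (chain_comp x e)"
  by (metis open_contains_ball ball_subset_chain_comp chain_comp_eq)

lemma closed_chain_comp:
  assumes "e > 0"
  shows "closed (chain_comp x e)"
proof -
  have "- chain_comp x e = (\<Union>y\<in>- chain_comp x e. chain_comp y e)"
  proof (intro subset_antisym subsetI)
    fix z assume "z \<in> (\<Union>y\<in>- chain_comp x e. chain_comp y e)"
    then obtain y where "y \<notin> chain_comp x e" "y \<in> chain_comp z e"
      using chain_comp_sym by auto
    then show "z \<in> - chain_comp x e" using chain_comp_trans by auto
  next
    fix z assume "z \<in> - chain_comp x e"
    then show "z \<in> (\<Union>y\<in>- chain_comp x e. chain_comp y e)" by (rule UN_I) simp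
  qed
  moreover have "open (\<Union>y\<in>- chain_comp x e. chain_comp y e)"
    using open_chain_comp[OF assms] by blast
  ultimately show ?thesis unfolding closed_def by simp
qed

lemma compact_chain_comp_antimono:
  assumes "compact (chain_comp x e')" "0 < e" "e \<le> e'"
  shows "compact (chain_comp x e)"
proof -
  have "chain_comp x e' \<inter> chain_comp x e = chain_comp x e"
    using chain_comp_mono[OF assms(3), of x] by blast
  then show ?thesis
    using compact_Int_closed[OF assms(1) closed_chain_comp[OF assms(2), of x]] by simp
qed

section \<open>Compactness thresholds and finite chain covers\<close>

lemma f_c_geI:
  assumes "compact (chain_comp x e)" "e > 0"
  shows "ennreal e \<le> f_c x"
proof -
  have "ennreal e \<le> (SUP \<epsilon>\<in>{\<epsilon>. \<epsilon> > 0 \<and> compact (chain_comp x \<epsilon>)}. ennreal \<epsilon>)"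
    using assms by (intro SUP_upper) auto
  moreover have "\<exists>\<epsilon>>0. compact (chain_comp x \<epsilon>)" using assms by blast
  ultimately show ?thesis by (simp only: f_c_def if_True)
qed

lemma less_f_cE:
  assumes "c < f_c x"
  obtains e where "e > 0" "c < ennreal e" "compact (chain_comp x e)"
proof -
  have "c < (SUP \<epsilon>\<in>{\<epsilon>. \<epsilon> > 0 \<and> compact (chain_comp x \<epsilon>)}. ennreal \<epsilon>)"
  proof (cases "\<exists>\<epsilon>>0. compact (chain_comp x \<epsilon>)")
    case True
    then show ?thesis using assms by (simp only: f_c_def if_True)
  next
    case False
    then have "f_c x = 0" by (simp only: f_c_def if_False)
    then show ?thesis using assms by simp
  qed
  then obtain e where "e \<in> {\<epsilon>. \<epsilon> > 0 \<and> compact (chain_comp x \<epsilon>)}" "c < ennreal e"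
    unfolding less_SUP_iff by (rule bexE)
  then show ?thesis by (intro that[of e]) simp_all
qed

lemma compact_chain_comp_if_less_f_c:
  assumes "ennreal e < f_c x" "e > 0"
  shows "compact (chain_comp x e)"
proof -
  obtain e' where "ennreal e < ennreal e'" "compact (chain_comp x e')"
    using assms(1) by (rule less_f_cE)
  then show ?thesis
    using compact_chain_comp_antimono[of x e' e] assms(2) by (simp add: ennreal_less_iff)
qed

text \<open>A witness \<open>\<epsilon>\<close> for \<open>f_c x > c\<close> is one for all of the open set \<open>chain_comp x \<epsilon>\<close>, whose points share
  that component; thus \<^const>\<open>f_c\<close> is lower semicontinuous.\<close>

lemma closed_f_c_le: "closed {x::'a::metric_space. f_c x \<le> c}"
proof -
  have "\<exists>T. open T \<and> x \<in> T \<and> T \<subseteq> - {x. f_c x \<le> c}" if "x \<in> - {x. f_c x \<le> c}" for x :: 'a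
  proof -
    from that have "c < f_c x" by (simp add: not_le)
    then obtain e where e: "e > 0" "c < ennreal e" "compact (chain_comp x e)" by (rule less_f_cE)
    have "c < f_c y" if "y \<in> chain_comp x e" for y
      using f_c_geI[of y e] e chain_comp_eq[OF that] by (simp add: less_le_trans)
    then have "chain_comp x e \<subseteq> - {x. f_c x \<le> c}" by (auto simp: not_le[symmetric])
    then show ?thesis
      using open_chain_comp[OF e(1), of x] chain_comp_refl by blast
  qed
  then show ?thesis unfolding closed_def by (subst open_subopen) blast
qed

lemma eta_star_le:
  assumes "e > 0" "finite F" "A \<subseteq> (\<Union>x\<in>F. chain_comp x e)"
  shows "eta_star A \<le> ennreal e"
  unfolding eta_star_def using assms by (intro INF_lower) auto

lemma eta_star_lessE:
  assumes "eta_star A < ennreal e" "e > 0"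
  obtains F where "finite F" "A \<subseteq> (\<Union>x\<in>F. chain_comp x e)"
proof -
  obtain e' F where "0 < e'" "ennreal e' < ennreal e" "finite F" "A \<subseteq> (\<Union>x\<in>F. chain_comp x e')"
    using assms(1) unfolding eta_star_def INF_less_iff by auto
  moreover from this have "e' \<le> e" by (simp add: ennreal_less_iff)
  ultimately show ?thesis using that[of F] chain_comp_mono[of e' e] by blast
qed

section \<open>Superparacompactness forces smallness\<close>

text \<open>Noncompact components that lie in pairwise different \<open>\<epsilon>\<close>-components contain infinite sets
  without limit points, and these stay locally finite when put together because the
  \<open>\<epsilon>\<close>-components are open.\<close>

lemma scattered_noncompact_components:
  fixes x :: "nat \<Rightarrow> 'a::metric_space"
  assumes e: "e > 0"
    and r: "\<And>n. 0 < r n" "\<And>n. r n \<le> e"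
    and noncomp: "\<And>n. \<not> compact (chain_comp (x n) (r n))"
    and distinct: "\<And>m n. m < n \<Longrightarrow> x n \<notin> chain_comp (x m) e"
  obtains D where "\<And>p. \<not> p islimpt D" "\<And>n. infinite (D \<inter> chain_comp (x n) (r n))"
proof -
  have "\<exists>T. infinite T \<and> T \<subseteq> chain_comp (x n) (r n) \<and> (\<forall>p. \<not> p islimpt T)" for n
  proof -
    obtain T where T: "infinite T" "T \<subseteq> chain_comp (x n) (r n)"
      "\<forall>p\<in>chain_comp (x n) (r n). \<not> p islimpt T"
      using noncomp[of n] unfolding compact_eq_Bolzano_Weierstrass by blast
    have "\<not> p islimpt T" for p
      using T(2,3) closed_chain_comp[OF r(1), of "x n" n] islimpt_subset closed_limpt by blast
    then show ?thesis using T by blast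
  qed
  then obtain T where T: "\<And>n. infinite (T n)" "\<And>n. T n \<subseteq> chain_comp (x n) (r n)"
    "\<And>n p. \<not> p islimpt T n" by metis
  have Te: "T n \<subseteq> chain_comp (x n) e" for n
    using T(2) chain_comp_mono[OF r(2)] by blast
  have index_unique: "m = n" if "x m \<in> chain_comp p e" "x n \<in> chain_comp p e" for m n p
    using that distinct[of m n] distinct[of n m] chain_comp_eq by (metis linorder_neqE_nat)
  have "\<not> p islimpt (\<Union>n. T n)" for p
  proof
    assume "p islimpt (\<Union>n. T n)"
    then have acc: "infinite (U \<inter> (\<Union>n. T n))" if "open U" "p \<in> U" for U
      using that islimpt_eq_acc_point by blast
    have "U \<inter> chain_comp p e \<inter> (\<Union>n. T n) \<noteq> {}" if "open U" "p \<in> U" for U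
      using acc[of "U \<inter> chain_comp p e"] open_chain_comp[OF e, of p] that by force
    from this[of UNIV] obtain n y where n: "y \<in> T n" "y \<in> chain_comp p e" by auto
    then have xn: "x n \<in> chain_comp p e"
      using Te chain_comp_sym chain_comp_trans by blast
    have "chain_comp p e \<inter> (\<Union>n. T n) \<subseteq> T n"
    proof
      fix z assume "z \<in> chain_comp p e \<inter> (\<Union>n. T n)"
      then obtain m where "z \<in> chain_comp p e" "z \<in> T m" by auto
      moreover from this have "x m \<in> chain_comp p e"
        using Te chain_comp_sym chain_comp_trans by blast
      ultimately show "z \<in> T n" using index_unique xn by blast
    qed
    then have "infinite (U \<inter> T n)" if "open U" "p \<in> U" for U
      using acc[of "U \<inter> chain_comp p e"] open_chain_comp[OF e, of p] that
        finite_subset[of "U \<inter> chain_comp p e \<inter> (\<Union>n. T n)" "U \<inter> T n"] by auto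
    then show False using T(3) islimpt_eq_acc_point by blast
  qed
  moreover have "infinite ((\<Union>n. T n) \<inter> chain_comp (x n) (r n))" for n
    using T(1)[of n] T(2)[of n] finite_subset[of "T n" "(\<Union>n. T n) \<inter> chain_comp (x n) (r n)"]
    by auto
  ultimately show ?thesis using that by blast
qed

text \<open>The cover that defeats every \<open>\<mu>\<close> consists of the open sets meeting \<open>D\<close> in a finite set, where \<open>D\<close>
  comes from the preceding lemma.\<close>

lemma small_f_c_imp_small_eta_star:
  assumes uss: "uniformly_star_superparacompact TYPE('a::metric_space)" and e: "e > 0"
  shows "\<exists>\<delta>::real. \<delta> > 0 \<and> (\<forall>A::'a set. f_c_sup A < ennreal \<delta> \<longrightarrow> eta_star A < ennreal e)"
proof (rule ccontr)
  assume neg: "\<not> ?thesis"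
  \<comment> \<open>The bound \<open>e / 2\<close> keeps the \<open>r n\<close>-components inside the separated \<open>e / 2\<close>-components.\<close>
  define r where "r n = min (e / 2) (1 / real (Suc n))" for n
  have r: "0 < r n" "r n \<le> e / 2" for n using e by (auto simp: r_def)
  have escape: "\<exists>a::'a. \<not> compact (chain_comp a (r n)) \<and> (\<forall>i<n. a \<notin> chain_comp (f i) (e / 2))" for n f
  proof -
    obtain A :: "'a set" where A: "f_c_sup A < ennreal (r n)" "\<not> eta_star A < ennreal e"
      using neg r(1)[of n] by blast
    have "\<not> A \<subseteq> (\<Union>p\<in>f ` {..<n}. chain_comp p (e / 2))"
    proof
      assume "A \<subseteq> (\<Union>p\<in>f ` {..<n}. chain_comp p (e / 2))"
      then have "eta_star A \<le> ennreal (e / 2)"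
        using e by (intro eta_star_le[of _ "f ` {..<n}"]) auto
      also have "\<dots> < ennreal e" using e by (simp add: ennreal_less_iff)
      finally show False using A by simp
    qed
    then obtain a where a: "a \<in> A" "\<forall>i<n. a \<notin> chain_comp (f i) (e / 2)" by auto
    have "f_c a < ennreal (r n)"
      using A(1) a(1) unfolding f_c_sup_def by (rule SUP_lessD)
    then have "\<not> compact (chain_comp a (r n))"
      using f_c_geI[of a "r n"] r(1)[of n] leD by blast
    with a show ?thesis by blast
  qed
  have "\<exists>x::nat \<Rightarrow> 'a. \<forall>n. \<not> compact (chain_comp (x n) (r n)) \<and> (\<forall>i<n. x n \<notin> chain_comp (x i) (e / 2))"
  proof (rule dependent_wellorder_choice)
    fix s :: 'a and f g :: "nat \<Rightarrow> 'a" and n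
    assume "\<And>i. i < n \<Longrightarrow> f i = g i"
    then show "(\<not> compact (chain_comp s (r n)) \<and> (\<forall>i<n. s \<notin> chain_comp (f i) (e / 2))) =
        (\<not> compact (chain_comp s (r n)) \<and> (\<forall>i<n. s \<notin> chain_comp (g i) (e / 2)))"
      by simp
  qed (rule escape)
  then obtain x :: "nat \<Rightarrow> 'a" where x: "\<And>n. \<not> compact (chain_comp (x n) (r n))"
    "\<And>m n. m < n \<Longrightarrow> x n \<notin> chain_comp (x m) (e / 2)" by blast
  obtain D where D: "\<And>p. \<not> p islimpt D" "\<And>n. infinite (D \<inter> chain_comp (x n) (r n))"
    using scattered_noncompact_components[of "e / 2" r x] e r x by auto
  have "\<exists>G. open G \<and> finite (G \<inter> D) \<and> p \<in> G" for p
    using D(1)[of p] unfolding islimpt_eq_acc_point by blast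
  then have "open_cover {G. open G \<and> finite (G \<inter> D)}"
    unfolding open_cover_def by auto
  then obtain \<mu> \<U> where \<mu>: "\<mu> > 0" and \<U>: "open_cover \<U>"
    "\<forall>U\<in>\<U>. \<exists>V\<in>{G. open G \<and> finite (G \<inter> D)}. U \<subseteq> V"
    "\<And>x. finite {U\<in>\<U>. chain_comp x \<mu> \<inter> U \<noteq> {}}"
    using uss[unfolded uniformly_star_superparacompact_def, rule_format,
        of "{G. open G \<and> finite (G \<inter> D)}"] by blast
  have finU: "finite (U \<inter> D)" if U: "U \<in> \<U>" for U
  proof -
    obtain V where "U \<subseteq> V" "finite (V \<inter> D)" using \<U>(2) U by auto
    show ?thesis by (rule finite_subset[OF _ \<open>finite (V \<inter> D)\<close>]) (use \<open>U \<subseteq> V\<close> in auto)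
  qed
  obtain n where "1 / real (Suc n) < \<mu>" using \<mu> nat_approx_posE by blast
  then have "r n \<le> \<mu>" by (simp add: r_def)
  then have sub: "chain_comp (x n) (r n) \<subseteq> chain_comp (x n) \<mu>" by (rule chain_comp_mono)
  have "D \<inter> chain_comp (x n) (r n) \<subseteq> (\<Union>U\<in>{U\<in>\<U>. chain_comp (x n) \<mu> \<inter> U \<noteq> {}}. U \<inter> D)"
  proof
    fix y assume y: "y \<in> D \<inter> chain_comp (x n) (r n)"
    have "y \<in> \<Union>\<U>" using \<U>(1) unfolding open_cover_def by simp
    then obtain U where "U \<in> \<U>" "y \<in> U" by (rule UnionE)
    then show "y \<in> (\<Union>U\<in>{U\<in>\<U>. chain_comp (x n) \<mu> \<inter> U \<noteq> {}}. U \<inter> D)"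
      using y sub by (intro UN_I[of U]) auto
  qed
  moreover have "finite (\<Union>U\<in>{U\<in>\<U>. chain_comp (x n) \<mu> \<inter> U \<noteq> {}}. U \<inter> D)"
    by (rule finite_UN_I[OF \<U>(3)]) (simp add: finU)
  ultimately have "finite (D \<inter> chain_comp (x n) (r n))" by (rule finite_subset)
  then show False using D(2) by blast
qed

section \<open>Smallness forces superparacompactness\<close>

text \<open>The sublevel sets of \<^const>\<open>f_c\<close> are closed, so the smallness condition applies to them and
  covers a tail of the sequence by finitely many \<open>\<epsilon>\<close>-components. One of these contains a subsequence;
  diagonalising over \<open>\<epsilon> = 1 / (n + 1)\<close> gives a Bourbaki quasi-Cauchy one. At its cluster point
  \<^const>\<open>f_c\<close> vanishes by lower semicontinuity.\<close>

lemma f_c_null_sequence_cluster: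
  fixes x :: "nat \<Rightarrow> 'a::metric_space"
  assumes bqc: "bourbaki_quasi_complete TYPE('a)"
    and small: "\<forall>\<epsilon>::real. \<epsilon> > 0 \<longrightarrow> (\<exists>\<delta>::real. \<delta> > 0 \<and>
        (\<forall>A::'a set. A \<noteq> {} \<and> closed A \<longrightarrow>
          f_c_sup A < ennreal \<delta> \<longrightarrow> eta_star A < ennreal \<epsilon>))"
    and x: "\<And>n. f_c (x n) \<le> ennreal (1 / real (Suc n))"
  obtains r p where "strict_mono r" "seq_cluster_point (x \<circ> r) p" "f_c p = 0"
proof -
  define P where "P n s \<longleftrightarrow> (\<exists>p. \<forall>i. x (s i) \<in> chain_comp p (1 / real (Suc n)))"
    for n and s :: "nat \<Rightarrow> nat"
  have tail: "f_c (x k) \<le> ennreal \<delta>" if "1 / real (Suc n) \<le> \<delta>" "n \<le> k" for n k \<delta>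
  proof -
    have "1 / real (Suc k) \<le> \<delta>"
      using that frac_le[of 1 1 "real (Suc n)" "real (Suc k)"] by simp
    then show ?thesis using order_trans[OF x[of k] ennreal_leI] by blast
  qed
  interpret subseqs P
  proof
    fix n s assume s: "strict_mono (s :: nat \<Rightarrow> nat)"
    define e where "e = 1 / real (Suc n)"
    have e: "e > 0" by (simp add: e_def)
    obtain \<delta> where \<delta>: "\<delta> > 0"
      "\<And>A::'a set. A \<noteq> {} \<Longrightarrow> closed A \<Longrightarrow> f_c_sup A < ennreal \<delta> \<Longrightarrow> eta_star A < ennreal e"
      using small[THEN spec, THEN mp, OF e] by blast
    obtain k where k: "1 / real (Suc k) < \<delta> / 2"
      using nat_approx_posE[of "\<delta> / 2"] \<delta>(1) by auto
    define A where "A = {y::'a. f_c y \<le> ennreal (\<delta> / 2)}"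
    have inA: "x j \<in> A" if "k \<le> j" for j
      using tail[OF less_imp_le[OF k] that] by (simp add: A_def)
    have "f_c_sup A \<le> ennreal (\<delta> / 2)"
      unfolding f_c_sup_def A_def by (intro SUP_least) auto
    also have "\<dots> < ennreal \<delta>" using \<delta>(1) by (simp add: ennreal_less_iff)
    finally have "eta_star A < ennreal e"
      using \<delta>(2)[of A] inA[of k] closed_f_c_le[of "ennreal (\<delta> / 2)"] unfolding A_def by blast
    then obtain F where F: "finite F" "A \<subseteq> (\<Union>y\<in>F. chain_comp y e)"
      using e by (rule eta_star_lessE)
    have "\<forall>i. \<exists>y\<in>F. x (s (i + k)) \<in> chain_comp y e"
    proof
      fix i
      have "k \<le> s (i + k)" using seq_suble[OF s, of "i + k"] by simp
      then show "\<exists>y\<in>F. x (s (i + k)) \<in> chain_comp y e" using inA F(2) by blast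
    qed
    then obtain g where g: "\<And>i. g i \<in> F" "\<And>i. x (s (i + k)) \<in> chain_comp (g i) e" by metis
    have "finite (range g)" by (rule finite_subset[OF _ F(1)]) (use g(1) in auto)
    then obtain i0 where i0: "infinite {i. g i = g i0}"
      using pigeonhole_infinite[of UNIV g] by auto
    define t where "t = enumerate {i. g i = g i0}"
    have t: "strict_mono t" unfolding t_def by (rule strict_mono_enumerate[OF i0])
    have gt: "g (t i) = g i0" for i using enumerate_in_set[OF i0, of i] unfolding t_def by simp
    have "P n (s \<circ> (\<lambda>i. t i + k))"
      unfolding P_def
    proof (intro exI allI)
      fix i show "x ((s \<circ> (\<lambda>i. t i + k)) i) \<in> chain_comp (g i0) (1 / real (Suc n))"
        using g(2)[of "t i"] unfolding gt e_def by simp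
    qed
    moreover have "strict_mono (\<lambda>i. t i + k)" using t by (simp add: strict_mono_def)
    ultimately show "\<exists>r'. strict_mono r' \<and> P n (s \<circ> r')" by blast
  qed
  have P_diag: "P n (diagseq \<circ> (+) (Suc n))" for n
    by (rule diagseq_holds) (auto simp: P_def)
  have "bourbaki_quasi_Cauchy (x \<circ> diagseq)"
    unfolding bourbaki_quasi_Cauchy_def
  proof (intro allI impI)
    fix \<epsilon> :: real assume "\<epsilon> > 0"
    then obtain n where n: "1 / real (Suc n) < \<epsilon>" using nat_approx_posE by blast
    obtain p where p: "\<And>i. x (diagseq (Suc n + i)) \<in> chain_comp p (1 / real (Suc n))"
      using P_diag[of n] unfolding P_def by auto
    have "(x \<circ> diagseq) j \<in> chain_comp p \<epsilon>" if "j \<ge> Suc n" for j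
      using p[of "j - Suc n"] that chain_comp_mono[OF less_imp_le[OF n], of p] by auto
    then show "\<exists>n0 p. \<forall>n\<ge>n0. (x \<circ> diagseq) n \<in> chain_comp p \<epsilon>" by blast
  qed
  then obtain p where p: "seq_cluster_point (x \<circ> diagseq) p"
    using bqc unfolding bourbaki_quasi_complete_def by blast
  have "f_c p = 0"
  proof (rule ccontr)
    assume "f_c p \<noteq> 0"
    then have "0 < f_c p" by (simp add: zero_less_iff_neq_zero)
    then obtain e where e: "e > 0" "compact (chain_comp p e)" by (rule less_f_cE)
    obtain n where n: "1 / real (Suc n) < e" using e(1) nat_approx_posE by blast
    have "\<exists>\<^sub>F k in sequentially. (x \<circ> diagseq) k \<in> chain_comp p e"
      using p open_chain_comp[OF e(1), of p] unfolding seq_cluster_point_def by simp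
    then obtain k where k: "k \<ge> n" "x (diagseq k) \<in> chain_comp p e"
      unfolding frequently_sequentially by auto
    have "ennreal e \<le> f_c (x (diagseq k))"
      using f_c_geI[of "x (diagseq k)" e] e chain_comp_eq[OF k(2)] by simp
    also have "\<dots> \<le> ennreal (1 / real (Suc n))"
      using tail[of n "1 / real (Suc n)" "diagseq k"] seq_suble[OF subseq_diagseq, of k] k(1) by simp
    also have "\<dots> < ennreal e" using n e(1) by (simp add: ennreal_less_iff)
    finally show False by simp
  qed
  then show ?thesis using that p subseq_diagseq by blast
qed

lemma compact_f_c_zero:
  assumes bqc: "bourbaki_quasi_complete TYPE('a::metric_space)"
    and small: "\<forall>\<epsilon>::real. \<epsilon> > 0 \<longrightarrow> (\<exists>\<delta>::real. \<delta> > 0 \<and>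
        (\<forall>A::'a set. A \<noteq> {} \<and> closed A \<longrightarrow>
          f_c_sup A < ennreal \<delta> \<longrightarrow> eta_star A < ennreal \<epsilon>))"
  shows "compact {x::'a. f_c x = 0}"
  unfolding compact_eq_Bolzano_Weierstrass
proof (intro allI impI)
  fix T :: "'a set" assume T: "infinite T \<and> T \<subseteq> {x. f_c x = 0}"
  then obtain x :: "nat \<Rightarrow> 'a" where x: "inj x" "range x \<subseteq> T"
    using infinite_countable_subset by blast
  have "f_c (x n) = 0" for n using x(2) T by blast
  then obtain r p where rp: "strict_mono r" "seq_cluster_point (x \<circ> r) p" "f_c p = 0"
    using f_c_null_sequence_cluster[OF bqc small, of x] by auto
  have "infinite (U \<inter> T)" if "open U" "p \<in> U" for U
  proof -
    have "infinite {n. (x \<circ> r) n \<in> U}"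
      using rp(2) that unfolding seq_cluster_point_def frequently_cofinite[symmetric]
        cofinite_eq_sequentially by blast
    moreover have "inj (x \<circ> r)" using x(1) rp(1) by (simp add: inj_compose strict_mono_imp_inj_on)
    ultimately have "infinite ((x \<circ> r) ` {n. (x \<circ> r) n \<in> U})"
      using finite_imageD inj_on_subset by blast
    moreover have "(x \<circ> r) ` {n. (x \<circ> r) n \<in> U} \<subseteq> U \<inter> T" using x(2) by auto
    ultimately show ?thesis using finite_subset by blast
  qed
  then show "\<exists>p\<in>{x. f_c x = 0}. p islimpt T" using rp(3) islimpt_eq_acc_point by blast
qed

text \<open>Points outside \<open>W\<close> with \<^const>\<open>f_c\<close> tending to \<open>0\<close> would cluster at a zero of \<^const>\<open>f_c\<close>, hence
  inside \<open>W\<close>.\<close>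

lemma small_f_c_near_zero_set:
  assumes bqc: "bourbaki_quasi_complete TYPE('a::metric_space)"
    and small: "\<forall>\<epsilon>::real. \<epsilon> > 0 \<longrightarrow> (\<exists>\<delta>::real. \<delta> > 0 \<and>
        (\<forall>A::'a set. A \<noteq> {} \<and> closed A \<longrightarrow>
          f_c_sup A < ennreal \<delta> \<longrightarrow> eta_star A < ennreal \<epsilon>))"
    and W: "open W" "{x::'a. f_c x = 0} \<subseteq> W"
  obtains \<mu> :: real where "\<mu> > 0" "{x. f_c x \<le> ennreal \<mu>} \<subseteq> W"
proof (rule ccontr)
  assume neg: "\<not> thesis"
  have "\<exists>x. f_c x \<le> ennreal (1 / real (Suc n)) \<and> x \<notin> W" for n
    using neg that[of "1 / real (Suc n)"] by auto
  then obtain x where x: "\<And>n. f_c (x n) \<le> ennreal (1 / real (Suc n))" "\<And>n. x n \<notin> W" by metis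
  obtain r p where rp: "seq_cluster_point (x \<circ> r) p" "f_c p = 0"
    using f_c_null_sequence_cluster[OF bqc small x(1)] by blast
  then have "\<exists>\<^sub>F n in sequentially. (x \<circ> r) n \<in> W"
    using W unfolding seq_cluster_point_def by blast
  then show False using x(2) by (simp add: frequently_def)
qed

text \<open>The refinement is global near the zero set of \<^const>\<open>f_c\<close>, by finitely many members \<open>\<W>\<close> of the
  cover, and local elsewhere: each compact \<open>\<mu>\<close>-component carries the traces of a finite subcover of
  its own, and these do not meet any other \<open>\<mu>\<close>-component.\<close>

lemma uniformly_star_superparacompactI:
  assumes bqc: "bourbaki_quasi_complete TYPE('a::metric_space)"
    and small: "\<forall>\<epsilon>::real. \<epsilon> > 0 \<longrightarrow> (\<exists>\<delta>::real. \<delta> > 0 \<and>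
        (\<forall>A::'a set. A \<noteq> {} \<and> closed A \<longrightarrow>
          f_c_sup A < ennreal \<delta> \<longrightarrow> eta_star A < ennreal \<epsilon>))"
  shows "uniformly_star_superparacompact TYPE('a)"
  unfolding uniformly_star_superparacompact_def
proof (intro allI impI)
  fix \<V> :: "'a set set" assume "open_cover \<V>"
  then have \<V>: "\<And>V. V \<in> \<V> \<Longrightarrow> open V" "\<Union>\<V> = UNIV"
    by (simp_all add: open_cover_def)
  have subcover: "\<exists>\<F>\<subseteq>\<V>. finite \<F> \<and> C \<subseteq> \<Union>\<F>" if "compact C" for C
  proof -
    have "C \<subseteq> \<Union>\<V>" using \<V>(2) by simp
    with that show ?thesis by (rule compactE) (use \<V>(1) in blast)+
  qed
  obtain \<W> where \<W>: "\<W> \<subseteq> \<V>" "finite \<W>" "{x. f_c x = 0} \<subseteq> \<Union>\<W>"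
    using subcover[OF compact_f_c_zero[OF bqc small]] by blast
  have "open (\<Union>\<W>)" using \<W>(1) \<V>(1) by blast
  then obtain \<mu> where \<mu>: "\<mu> > 0" "{x. f_c x \<le> ennreal \<mu>} \<subseteq> \<Union>\<W>"
    by (rule small_f_c_near_zero_set[OF bqc small _ \<W>(3)])
  obtain \<F> where \<F>: "\<F> C \<subseteq> \<V> \<and> finite (\<F> C) \<and> C \<subseteq> \<Union>(\<F> C)" if "compact C" for C
  proof -
    have "\<forall>C\<in>Collect compact. \<exists>\<F>. \<F> \<subseteq> \<V> \<and> finite \<F> \<and> C \<subseteq> \<Union>\<F>"
      using subcover by simp
    from bchoice[OF this] show ?thesis using that by auto
  qed
  \<comment> \<open>The finite subcover is chosen for the component as a set, so that all points of one component
    contribute the same sets.\<close>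
  define local_part where
    "local_part x = (\<lambda>V. V \<inter> chain_comp x \<mu>) ` \<F> (chain_comp x \<mu>)" for x
  define \<U> where "\<U> = \<W> \<union> (\<Union>x\<in>{x. compact (chain_comp x \<mu>)}. local_part x)"
  have "open U" if inU: "U \<in> \<U>" for U
  proof (cases "U \<in> \<W>")
    case True
    then show ?thesis using \<W>(1) \<V>(1) by blast
  next
    case False
    then obtain x V where "compact (chain_comp x \<mu>)" "V \<in> \<F> (chain_comp x \<mu>)"
      and U: "U = V \<inter> chain_comp x \<mu>"
      using inU unfolding \<U>_def local_part_def by blast
    then have "open V" using \<F> \<V>(1) by blast
    then show ?thesis unfolding U by (rule open_Int[OF _ open_chain_comp[OF \<mu>(1)]])
  qed
  moreover have "x \<in> \<Union>\<U>" for x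
  proof (cases "x \<in> \<Union>\<W>")
    case False
    then have "ennreal \<mu> < f_c x" using \<mu>(2) by (metis mem_Collect_eq not_le subsetD)
    then have "compact (chain_comp x \<mu>)" using \<mu>(1) by (rule compact_chain_comp_if_less_f_c)
    moreover from this obtain V where "V \<in> \<F> (chain_comp x \<mu>)" "x \<in> V"
      using \<F>[of "chain_comp x \<mu>"] chain_comp_refl[of x \<mu>] by (meson UnionE subsetD)
    moreover from this have "V \<inter> chain_comp x \<mu> \<in> local_part x"
      unfolding local_part_def by blast
    ultimately show ?thesis unfolding \<U>_def using chain_comp_refl[of x \<mu>] by blast
  qed (auto simp: \<U>_def)
  ultimately have "open_cover \<U>" unfolding open_cover_def by auto
  moreover have "\<forall>U\<in>\<U>. \<exists>V\<in>\<V>. U \<subseteq> V"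
  proof
    fix U assume "U \<in> \<U>"
    then consider "U \<in> \<W>" | x where "compact (chain_comp x \<mu>)" "U \<in> local_part x"
      unfolding \<U>_def by blast
    then show "\<exists>V\<in>\<V>. U \<subseteq> V"
    proof cases
      case 1
      then show ?thesis using \<W>(1) by auto
    next
      case 2
      then show ?thesis using \<F>[OF 2(1)] unfolding local_part_def by auto
    qed
  qed
  moreover have "finite {U\<in>\<U>. chain_comp x \<mu> \<inter> U \<noteq> {}}" for x
  proof -
    have same: "chain_comp x \<mu> = chain_comp y \<mu>"
      if meets: "chain_comp x \<mu> \<inter> U \<noteq> {}" "U \<in> local_part y" for U y
    proof -
      obtain z where "z \<in> chain_comp x \<mu>" "z \<in> chain_comp y \<mu>"
        using meets unfolding local_part_def by blast
      then show ?thesis using chain_comp_eq by metis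
    qed
    have "{U\<in>\<U>. chain_comp x \<mu> \<inter> U \<noteq> {}} \<subseteq>
        \<W> \<union> (if compact (chain_comp x \<mu>) then local_part x else {})"
    proof
      fix U assume U: "U \<in> {U\<in>\<U>. chain_comp x \<mu> \<inter> U \<noteq> {}}"
      show "U \<in> \<W> \<union> (if compact (chain_comp x \<mu>) then local_part x else {})"
      proof (cases "U \<in> \<W>")
        case False
        then obtain y where y: "compact (chain_comp y \<mu>)" "U \<in> local_part y"
          using U unfolding \<U>_def by blast
        then have "chain_comp x \<mu> = chain_comp y \<mu>" using same U by blast
        then show ?thesis using y unfolding local_part_def by simp
      qed simp
    qed
    moreover have "finite (\<W> \<union> (if compact (chain_comp x \<mu>) then local_part x else {}))"
      using \<W>(2) \<F> unfolding local_part_def by auto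
    ultimately show ?thesis by (rule finite_subset)
  qed
  ultimately show "\<exists>\<mu>>0. \<exists>\<U>. open_cover \<U> \<and> (\<forall>U\<in>\<U>. \<exists>V\<in>\<V>. U \<subseteq> V) \<and>
        (\<forall>x. finite {U\<in>\<U>. chain_comp x \<mu> \<inter> U \<noteq> {}})"
    using \<mu>(1) by blast
qed

theorem mainTheorem8:
  assumes "\<exists>x y::'a::metric_space. x \<noteq> y"
    and "bourbaki_quasi_complete TYPE('a)"
  shows "uniformly_star_superparacompact TYPE('a) \<longleftrightarrow>
    (\<forall>\<epsilon>::real. \<epsilon> > 0 \<longrightarrow>
      (\<exists>\<delta>::real. \<delta> > 0 \<and>
        (\<forall>A::'a set. A \<noteq> {} \<and> closed A \<longrightarrow>
          f_c_sup A < ennreal \<delta> \<longrightarrow> eta_star A < ennreal \<epsilon>)))"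
  (is "_ \<longleftrightarrow> ?small")
proof
  assume "uniformly_star_superparacompact TYPE('a)"
  then show ?small using small_f_c_imp_small_eta_star by meson
next
  assume ?small
  then show "uniformly_star_superparacompact TYPE('a)"
    by (rule uniformly_star_superparacompactI[OF assms(2)])
qed

end
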